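(* Let $\mathcal{M}'_m$ be a meridian surface of elliptic type in the Minkowski space $\mathbb{R}^4_1$, parameterized by $z(u,v)=f(u)\,l(v)+g(u)\,e_4$, $u\in I$, $v\in J$, constructed from the meridian curve $m:u\mapsto(f(u),g(u))$ and the curve $c:l=l(v)$. Then $\mathcal{M}'_m$ has pointwise 1-type Gauss map of first kind if and only if the curve $c$ has zero spherical curvature and the meridian curve $m$ is determined by a solution $f(u)$ of the differential equation $$f\left(\frac{f f''}{\sqrt{f'^2-1}}\right)'-f'\sqrt{f'^2-1}=0,$$ with $g(u)$ defined by $g'(u)=\sqrt{f'^2(u)-1}$.
   Context: $\mathbb{R}^4_1$ (also written $\mathbb{E}^4_1$) is the four-dimensional Minkowski space with flat metric $\langle\cdot,\cdot\rangle$ of signature $(3,1)$ and fixed orthonormal frame $e_1,e_2,e_3,e_4$, $\langle e_i,e_i\rangle=1$ for $i=1,2,3$, $\langle e_4,e_4\rangle=-1$. Meridian surface of elliptic type: let $f,g:I\to\mathbb{R}$ be smooth functions on an interval $I\subset\mathbb{R}$ with $f(u)>0$ and $(f'(u))^2-(g'(u))^2=1$ for all $u\in I$ (the plane curve $m:u\mapsto(f(u),g(u))$ is called the meridian curve). Let $c: l=l(v)$, $v\in J$ ($J\subset\mathbb{R}$ an interval), be a smooth curve parameterized by arc-length ($\langle l',l'\rangle=1$) on the unit sphere $S^2(1)$ centered at the origin of the Euclidean space $\mathbb{R}^3=\operatorname{span}\{e_1,e_2,e_3\}$. The surface $\mathcal{M}'_m: z(u,v)=f(u)\,l(v)+g(u)\,e_4$,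 $u\in I,\ v\in J$, is called a meridian surface of elliptic type; it is spacelike with first fundamental form $du^2+f^2(u)\,dv^2$. Spherical curvature of $c$: put $t=l'$ and let $n(v)$ be the (unique up to sign) vector field such that $\{l,t,n\}$ is an orthonormal frame field of $\mathbb{R}^3$; then $\kappa(v)=\langle t'(v),n(v)\rangle$, and $l'=t$, $t'=\kappa n-l$, $n'=-\kappa t$. Gauss map: with $x=z_u$ and $y=z_v/f$ (an orthonormal tangent frame), the Gauss map is $G=x\wedge y$, regarded as a map from the surface into the vector space $\wedge^2\mathbb{R}^4_1$, equipped with the indefinite inner product $\langle a_1\wedge a_2, b_1\wedge b_2\rangle=\det(\langle a_k,b_l\rangle)$. Laplacian: $\Delta G=-\nabla'_x\nabla'_xG+\nabla'_{\nabla_xx}G-\nabla'_y\nabla'_yG+\nabla'_{\nabla_yy}G$, where $\nabla'$ is the flat connection of the ambient space (componentwise differentiation) and $\nabla$ is the Levi-Civita connection of the surface. The surface has pointwise 1-type Gauss map of first kind if $\Delta G=\lambda G$ for some non-zero smooth function $\lambda$ on the surface.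
   Formalization: The differential equation is required only where f'^2>1, a set that must be dense in I, and g'=sqrt(f'^2-1) is taken up to sign; read literally the "only if" fails, e.g. for f=sqrt(2e^u-1), g'=(f-1/f)/2 and c a great circle, where g' changes sign at u=0. *)

theory Defs
  imports "HOL-Analysis.Analysis"
begin

section \<open>Calculus on intervals\<close>

text \<open>Derivatives are taken within the parameter interval, so that intervals containing
  endpoints are covered (one-sided derivatives there).\<close>

definition ivl_deriv :: "real set \<Rightarrow> (real \<Rightarrow> 'a) \<Rightarrow> real \<Rightarrow> 'a :: real_normed_vector"
  where "ivl_deriv I f u = vector_derivative f (at u within I)"

definition smooth_on_ivl :: "real set \<Rightarrow> (real \<Rightarrow> 'a :: real_normed_vector) \<Rightarrow> bool"
  where "smooth_on_ivl I f \<longleftrightarrow>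
    (\<forall>k. \<forall>u\<in>I. (ivl_deriv I ^^ k) f differentiable (at u within I))"

text \<open>Maps on a parameter rectangle \<open>I \<times> J\<close> are curried. The index \<open>1 :: 2\<close> stands for the
  parameter \<open>u\<close>, the index \<open>2 :: 2\<close> for the parameter \<open>v\<close>.\<close>

definition pd :: "real set \<Rightarrow> real set \<Rightarrow> 2 \<Rightarrow> (real \<Rightarrow> real \<Rightarrow> 'a)
    \<Rightarrow> real \<Rightarrow> real \<Rightarrow> 'a :: real_normed_vector"
  where "pd I J i F u v =
    (if i = 1 then ivl_deriv I (\<lambda>s. F s v) u else ivl_deriv J (\<lambda>s. F u s) v)"

definition smooth_on_rect ::
    "real set \<Rightarrow> real set \<Rightarrow> (real \<Rightarrow> real \<Rightarrow> 'a :: real_normed_vector) \<Rightarrow> bool"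
  where "smooth_on_rect I J F \<longleftrightarrow> (\<forall>ks. let H = foldr (pd I J) ks F in
    continuous_on (I \<times> J) (\<lambda>(u, v). H u v) \<and>
    (\<forall>u\<in>I. \<forall>v\<in>J. (\<lambda>s. H s v) differentiable (at u within I) \<and>
                  (\<lambda>s. H u s) differentiable (at v within J)))"

section \<open>Minkowski space and its bivectors\<close>

definition mink :: "real ^ 4 \<Rightarrow> real ^ 4 \<Rightarrow> real"
  where "mink a b = a $ 1 * b $ 1 + a $ 2 * b $ 2 + a $ 3 * b $ 3 - a $ 4 * b $ 4"

definition ee :: "4 \<Rightarrow> real ^ 4"
  where "ee i = axis i 1"

definition unit_sphere2 :: "(real ^ 4) set"
  where "unit_sphere2 = {w \<in> span {ee 1, ee 2, ee 3}. mink w w = 1}"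

text \<open>The second exterior power is realised as the space of skew-symmetric matrices.\<close>

definition wedge :: "real ^ 4 \<Rightarrow> real ^ 4 \<Rightarrow> real ^ 4 ^ 4"
  where "wedge a b = (\<chi> i j. a $ i * b $ j - a $ j * b $ i)"

section \<open>Geometry of a parametrised spacelike surface\<close>

text \<open>A tangent vector field is given by its two components with respect to the coordinate
  fields \<open>z\<^sub>u\<close>, \<open>z\<^sub>v\<close>. \<open>flat_deriv I J X F\<close> is the componentwise derivative of the map \<open>F\<close>
  along the tangent field \<open>X\<close>; in particular \<open>flat_deriv I J X z\<close> is \<open>X\<close> as a field of vectors
  of the ambient space.\<close>

type_synonym tfield = "real \<Rightarrow> real \<Rightarrow> real ^ 2"

definition flat_deriv :: "real set \<Rightarrow> real set \<Rightarrow> tfield \<Rightarrow> (real \<Rightarrow> real \<Rightarrow> 'a)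
    \<Rightarrow> real \<Rightarrow> real \<Rightarrow> 'a :: real_normed_vector"
  where "flat_deriv I J X F u v = (\<Sum>i\<in>UNIV. X u v $ i *\<^sub>R pd I J i F u v)"

definition first_form :: "real set \<Rightarrow> real set \<Rightarrow> (real \<Rightarrow> real \<Rightarrow> real ^ 4)
    \<Rightarrow> real \<Rightarrow> real \<Rightarrow> real ^ 2 ^ 2"
  where "first_form I J z u v = (\<chi> i j. mink (pd I J i z u v) (pd I J j z u v))"

definition christoffel :: "real set \<Rightarrow> real set \<Rightarrow> (real \<Rightarrow> real \<Rightarrow> real ^ 4)
    \<Rightarrow> 2 \<Rightarrow> 2 \<Rightarrow> 2 \<Rightarrow> real \<Rightarrow> real \<Rightarrow> real"
  where "christoffel I J z k i j u v =
    (\<Sum>m\<in>UNIV. matrix_inv (first_form I J z u v) $ k $ m *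
       (pd I J i (\<lambda>u v. first_form I J z u v $ j $ m) u v
        + pd I J j (\<lambda>u v. first_form I J z u v $ i $ m) u v
        - pd I J m (\<lambda>u v. first_form I J z u v $ i $ j) u v)) / 2"

definition levi_civita :: "real set \<Rightarrow> real set \<Rightarrow> (real \<Rightarrow> real \<Rightarrow> real ^ 4)
    \<Rightarrow> tfield \<Rightarrow> tfield \<Rightarrow> tfield"
  where "levi_civita I J z X Y u v = (\<chi> k.
    flat_deriv I J X (\<lambda>u v. Y u v $ k) u v
    + (\<Sum>i\<in>UNIV. \<Sum>j\<in>UNIV. christoffel I J z k i j u v * X u v $ i * Y u v $ j))"

text \<open>In the next three definitions \<open>X\<close>, \<open>Y\<close> is an orthonormal tangent frame of \<open>z\<close>.\<close>

definition gauss_map :: "real set \<Rightarrow> real set \<Rightarrow> (real \<Rightarrow> real \<Rightarrow> real ^ 4)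
    \<Rightarrow> tfield \<Rightarrow> tfield \<Rightarrow> real \<Rightarrow> real \<Rightarrow> real ^ 4 ^ 4"
  where "gauss_map I J z X Y u v = wedge (flat_deriv I J X z u v) (flat_deriv I J Y z u v)"

definition laplacian :: "real set \<Rightarrow> real set \<Rightarrow> (real \<Rightarrow> real \<Rightarrow> real ^ 4)
    \<Rightarrow> tfield \<Rightarrow> tfield \<Rightarrow> (real \<Rightarrow> real \<Rightarrow> 'a) \<Rightarrow> real \<Rightarrow> real \<Rightarrow> 'a :: real_normed_vector"
  where "laplacian I J z X Y F u v =
    - flat_deriv I J X (flat_deriv I J X F) u v
    + flat_deriv I J (levi_civita I J z X X) F u v
    - flat_deriv I J Y (flat_deriv I J Y F) u v
    + flat_deriv I J (levi_civita I J z Y Y) F u v"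

definition pointwise_1_type_first_kind :: "real set \<Rightarrow> real set
    \<Rightarrow> (real \<Rightarrow> real \<Rightarrow> real ^ 4) \<Rightarrow> tfield \<Rightarrow> tfield \<Rightarrow> bool"
  where "pointwise_1_type_first_kind I J z X Y \<longleftrightarrow>
    (\<exists>\<phi>. smooth_on_rect I J \<phi> \<and> (\<exists>u\<in>I. \<exists>v\<in>J. \<phi> u v \<noteq> 0) \<and>
      (\<forall>u\<in>I. \<forall>v\<in>J. laplacian I J z X Y (gauss_map I J z X Y) u v
                   = \<phi> u v *\<^sub>R gauss_map I J z X Y u v))"

section \<open>Meridian surfaces of elliptic type\<close>

definition meridian_surface :: "(real \<Rightarrow> real) \<Rightarrow> (real \<Rightarrow> real) \<Rightarrow> (real \<Rightarrow> real ^ 4)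
    \<Rightarrow> real \<Rightarrow> real \<Rightarrow> real ^ 4"
  where "meridian_surface f g l u v = f u *\<^sub>R l v + g u *\<^sub>R ee 4"

text \<open>The orthonormal frame \<open>x = z\<^sub>u\<close>, \<open>y = z\<^sub>v / f\<close>.\<close>

definition frame_x :: tfield
  where "frame_x u v = axis 1 1"

definition frame_y :: "(real \<Rightarrow> real) \<Rightarrow> tfield"
  where "frame_y f u v = axis 2 (1 / f u)"

text \<open>The normal field \<open>n\<close> of the spherical curve \<open>l\<close> within the span of \<open>ee 1, ee 2, ee 3\<close>, which is
  unique up to sign.\<close>

definition spherical_normal :: "real set \<Rightarrow> (real \<Rightarrow> real ^ 4) \<Rightarrow> (real \<Rightarrow> real ^ 4) \<Rightarrow> bool"
  where "spherical_normal J l n \<longleftrightarrow> smooth_on_ivl J n \<and>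
    (\<forall>v\<in>J. n v \<in> span {ee 1, ee 2, ee 3} \<and> mink (n v) (n v) = 1 \<and>
           mink (n v) (l v) = 0 \<and> mink (n v) (ivl_deriv J l v) = 0)"

definition spherical_curvature :: "real set \<Rightarrow> (real \<Rightarrow> real ^ 4) \<Rightarrow> (real \<Rightarrow> real ^ 4)
    \<Rightarrow> real \<Rightarrow> real"
  where "spherical_curvature J l n v = mink (ivl_deriv J (ivl_deriv J l) v) (n v)"

text \<open>The differential equation is meaningful only where \<open>f'\<^sup>2 > 1\<close>.\<close>

definition meridian_ode :: "real set \<Rightarrow> (real \<Rightarrow> real) \<Rightarrow> real \<Rightarrow> bool"
  where "meridian_ode I f u \<longleftrightarrow>
    f u * ivl_deriv I (\<lambda>s. f s * ivl_deriv I (ivl_deriv I f) s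
                             / sqrt ((ivl_deriv I f s)\<^sup>2 - 1)) u
    - ivl_deriv I f u * sqrt ((ivl_deriv I f u)\<^sup>2 - 1) = 0"

text \<open>The meridian curve \<open>(f, g)\<close> is determined by a solution \<open>f\<close> of the differential equation.
  The equation is required wherever it is meaningful, and these points have to be dense in \<open>I\<close>;
  this excludes the degenerate case \<open>f'\<^sup>2 = 1\<close>, in which (for zero spherical curvature)
  the surface is a piece of a plane and its Gauss map is constant. Points with \<open>g' = 0\<close> cannot be excluded altogether: for
  \<open>f u = sqrt (2 * exp u - 1)\<close>, \<open>g' = (f - 1 / f) / 2\<close> and \<open>l\<close> a great circle, the Gauss map is of
  pointwise 1-type of the first kind, and \<open>g'\<close> changes its sign at \<open>u = 0\<close>. The defining equation
  \<open>g' = sqrt (f'\<^sup>2 - 1)\<close> is accordingly understood up to the sign of \<open>g'\<close>, as a reflection of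
  \<open>g\<close> is an isometry of the ambient space.\<close>

definition meridian_from_ode :: "real set \<Rightarrow> (real \<Rightarrow> real) \<Rightarrow> (real \<Rightarrow> real) \<Rightarrow> bool"
  where "meridian_from_ode I f g \<longleftrightarrow>
    I \<subseteq> closure {u \<in> I. (ivl_deriv I f u)\<^sup>2 > 1} \<and>
    (\<forall>u\<in>I. (ivl_deriv I f u)\<^sup>2 > 1 \<longrightarrow> meridian_ode I f u) \<and>
    (\<forall>u\<in>I. \<bar>ivl_deriv I g u\<bar> = sqrt ((ivl_deriv I f u)\<^sup>2 - 1))"

end

theory Submission
  imports Defs
begin

text \<open>In the orthonormal frame \<open>l, t, n, e\<^sub>4\<close> the Gauss map is \<open>G = f' l \<and> t + g' e\<^sub>4 \<and> t\<close>, and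
  \<open>\<Delta>G = - G\<^sub>u\<^sub>u - (f'/f) G\<^sub>u - G\<^sub>v\<^sub>v / f\<^sup>2\<close>. The \<open>t \<and> n\<close> component of \<open>\<Delta>G\<close> is \<open>- f' \<kappa> / f\<^sup>2\<close>, and
  \<open>f'\<close> has no zeros, so \<open>\<Delta>G = \<lambda>G\<close> forces \<open>\<kappa> = 0\<close>. If \<open>\<kappa> = 0\<close>, put \<open>w = f' g'' - g' f''\<close>; then
  \<open>f'' = g' w\<close> and \<open>g'' = f' w\<close>, and the two remaining components amount to
  \<open>\<lambda> = - w\<^sup>2 - (g'/f)\<^sup>2\<close> and \<open>f (f w)' = f' g'\<close>. The latter is the differential equation wherever
  \<open>g' \<noteq> 0\<close>, and it is linear in \<open>(g', f w)\<close>: if \<open>g'\<close> vanishes on a subinterval, then \<open>g'\<close> and \<open>w\<close>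
  vanish identically and \<open>\<lambda> = 0\<close>.\<close>

section \<open>Smooth functions on a nondegenerate interval\<close>

locale nondegenerate_interval =
  fixes I :: "real set"
  assumes ivl: "is_interval I" and int_nonempty: "interior I \<noteq> {}"
begin

text \<open>A connected set with more than one point has no isolated points. This is what makes
  derivatives within \<open>I\<close> unique, also at endpoints.\<close>

lemma at_within_nontrivial:
  assumes "u \<in> I" shows "at u within I \<noteq> bot"
proof -
  have "u islimpt I"
  proof (rule connected_imp_perfect)
    show "connected I" using ivl by (simp add: is_interval_connected)
    show "I \<noteq> {x}" for x using int_nonempty by (metis interior_singleton)
  qed (rule assms)
  then show ?thesis by (simp add: trivial_limit_within)
qed

text \<open>Main computational tool: a formula valid only on \<open>I\<close> may be differentiated
  instead of \<open>F\<close>. Applied twice to one function, once through an identity and once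
  through the differentiation rules, it yields the derivative of that identity.\<close>

lemma ivl_deriv_eqI:
  assumes "u \<in> I" "\<And>s. s \<in> I \<Longrightarrow> F s = H s"
    and "(H has_vector_derivative y) (at u within I)"
  shows "ivl_deriv I F u = y"
proof -
  have "(F has_vector_derivative y) (at u within I)"
    by (rule has_vector_derivative_transform[OF assms(1) assms(2) assms(3)])
  then show ?thesis unfolding ivl_deriv_def
    by (intro vector_derivative_within at_within_nontrivial assms)
qed

text \<open>No differentiability is assumed: both functions have the same candidate derivatives, so
  the choice operator behind \<open>vector_derivative\<close> picks the same value.\<close>

lemma ivl_deriv_cong:
  assumes "u \<in> I" "\<And>s. s \<in> I \<Longrightarrow> F s = H s"
  shows "ivl_deriv I F u = ivl_deriv I H u"
proof -
  have "(F has_vector_derivative y) (at u within I) \<longleftrightarrow>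
        (H has_vector_derivative y) (at u within I)" for y
    using has_vector_derivative_transform[OF assms(1), of F H]
      has_vector_derivative_transform[OF assms(1), of H F] assms(2) by metis
  then show ?thesis by (simp add: ivl_deriv_def vector_derivative_def)
qed

lemma ivl_deriv_works:
  assumes "F differentiable (at u within I)"
  shows "(F has_vector_derivative ivl_deriv I F u) (at u within I)"
  using assms by (simp add: ivl_deriv_def vector_derivative_works)

lemma differentiable_cong_on:
  assumes "u \<in> I" "\<And>s. s \<in> I \<Longrightarrow> F s = H s" "H differentiable (at u within I)"
  shows "F differentiable (at u within I)"
  using has_vector_derivative_transform[OF assms(1,2) ivl_deriv_works[OF assms(3)]]
  by (rule differentiableI_vector)

text \<open>Smoothness is cut into finite orders so that closure under products and inverses can be
  proved by induction: their derivatives are built from functions that are smooth to one order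
  less.\<close>

definition smooth_upto :: "nat \<Rightarrow> (real \<Rightarrow> 'a :: real_normed_vector) \<Rightarrow> bool"
  where "smooth_upto k F \<longleftrightarrow>
    (\<forall>j<k. \<forall>u\<in>I. (ivl_deriv I ^^ j) F differentiable (at u within I))"

lemma smooth_on_ivl_iff: "smooth_on_ivl I F \<longleftrightarrow> (\<forall>k. smooth_upto k F)"
  unfolding smooth_on_ivl_def smooth_upto_def by blast

lemma smooth_upto_0: "smooth_upto 0 F"
  by (simp add: smooth_upto_def)

lemma smooth_upto_Suc:
  "smooth_upto (Suc k) F \<longleftrightarrow>
    (\<forall>u\<in>I. F differentiable (at u within I)) \<and> smooth_upto k (ivl_deriv I F)"
proof -
  have "(ivl_deriv I ^^ j) (ivl_deriv I F) = (ivl_deriv I ^^ Suc j) F" for j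
    by (simp add: funpow_swap1)
  then show ?thesis unfolding smooth_upto_def
    by (auto simp: less_Suc_eq_0_disj simp del: funpow.simps(2))
qed

lemma smooth_upto_SucD: "smooth_upto (Suc k) F \<Longrightarrow> smooth_upto k F"
  by (auto simp: smooth_upto_def)

lemma smooth_upto_cong:
  assumes "\<And>s. s \<in> I \<Longrightarrow> F s = H s" "smooth_upto k H"
  shows "smooth_upto k F"
  using assms
proof (induction k arbitrary: F H)
  case (Suc k)
  then show ?case unfolding smooth_upto_Suc
    using differentiable_cong_on[of _ F H] ivl_deriv_cong[of _ F H] by metis
qed (simp add: smooth_upto_0)

lemma smooth_upto_SucI:
  assumes "\<And>u. u \<in> I \<Longrightarrow> (F has_vector_derivative F' u) (at u within I)" "smooth_upto k F'"
  shows "smooth_upto (Suc k) F"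
  unfolding smooth_upto_Suc
proof (intro conjI ballI)
  show "smooth_upto k (ivl_deriv I F)"
    using smooth_upto_cong[OF ivl_deriv_eqI[OF _ refl assms(1)] assms(2)] by blast
qed (use assms(1) differentiableI_vector in blast)

lemma smooth_upto_Suc_has_ivl_deriv:
  "smooth_upto (Suc k) F \<Longrightarrow> u \<in> I \<Longrightarrow>
    (F has_vector_derivative ivl_deriv I F u) (at u within I)"
  by (simp add: smooth_upto_Suc ivl_deriv_works)

lemma smooth_upto_const: "smooth_upto k (\<lambda>_. c)"
proof (induction k arbitrary: c)
  case (Suc k)
  show ?case
    by (rule smooth_upto_SucI[OF has_vector_derivative_const Suc.IH])
qed (simp add: smooth_upto_0)

lemma smooth_upto_add:
  assumes "smooth_upto k F" "smooth_upto k H"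
  shows "smooth_upto k (\<lambda>s. F s + H s)"
  using assms
proof (induction k arbitrary: F H)
  case (Suc k)
  show ?case
  proof (rule smooth_upto_SucI)
    show "smooth_upto k (\<lambda>u. ivl_deriv I F u + ivl_deriv I H u)"
      using Suc by (simp add: smooth_upto_Suc)
  qed (intro has_vector_derivative_add smooth_upto_Suc_has_ivl_deriv[OF Suc.prems(1)] smooth_upto_Suc_has_ivl_deriv[OF Suc.prems(2)])
qed (simp add: smooth_upto_0)

lemma smooth_upto_mult:
  fixes F H :: "real \<Rightarrow> 'a :: real_normed_algebra"
  assumes "smooth_upto k F" "smooth_upto k H"
  shows "smooth_upto k (\<lambda>s. F s * H s)"
  using assms
proof (induction k arbitrary: F H)
  case (Suc k)
  show ?case
  proof (rule smooth_upto_SucI)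
    show "smooth_upto k (\<lambda>u. F u * ivl_deriv I H u + ivl_deriv I F u * H u)"
      using Suc.prems smooth_upto_SucD[OF Suc.prems(1)] smooth_upto_SucD[OF Suc.prems(2)]
      by (intro smooth_upto_add Suc.IH) (auto simp: smooth_upto_Suc)
  qed (intro has_vector_derivative_mult smooth_upto_Suc_has_ivl_deriv[OF Suc.prems(1)] smooth_upto_Suc_has_ivl_deriv[OF Suc.prems(2)])
qed (simp add: smooth_upto_0)

lemma smooth_upto_inverse:
  fixes F :: "real \<Rightarrow> real"
  assumes "smooth_upto k F" "\<And>u. u \<in> I \<Longrightarrow> F u \<noteq> 0"
  shows "smooth_upto k (\<lambda>s. inverse (F s))"
  using assms
proof (induction k)
  case (Suc k)
  show ?case
  proof (rule smooth_upto_SucI)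
    \<comment> \<open>Sign and square are spelled out as products, so that the product rule,
      constants and the induction hypothesis suffice.\<close>
    show "smooth_upto k (\<lambda>u. (- 1) * (ivl_deriv I F u * (inverse (F u) * inverse (F u))))"
      using Suc smooth_upto_SucD[OF Suc.prems(1)]
      by (intro smooth_upto_mult smooth_upto_const) (auto simp: smooth_upto_Suc)
    fix u assume u: "u \<in> I"
    have "(F has_field_derivative ivl_deriv I F u) (at u within I)"
      using smooth_upto_Suc_has_ivl_deriv[OF Suc.prems(1) u]
      by (simp add: has_real_derivative_iff_has_vector_derivative)
    from DERIV_inverse'[OF this Suc.prems(2)[OF u]]
    show "((\<lambda>s. inverse (F s)) has_vector_derivative
      (- 1) * (ivl_deriv I F u * (inverse (F u) * inverse (F u)))) (at u within I)"
      by (simp add: has_real_derivative_iff_has_vector_derivative ac_simps)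
  qed
qed (simp add: smooth_upto_0)

lemma smooth_const: "smooth_on_ivl I (\<lambda>_. c)"
  by (simp add: smooth_on_ivl_iff smooth_upto_const)

lemma smooth_add: "smooth_on_ivl I F \<Longrightarrow> smooth_on_ivl I H \<Longrightarrow> smooth_on_ivl I (\<lambda>s. F s + H s)"
  by (simp add: smooth_on_ivl_iff smooth_upto_add)

lemma smooth_mult:
  fixes F H :: "real \<Rightarrow> 'a :: real_normed_algebra"
  shows "smooth_on_ivl I F \<Longrightarrow> smooth_on_ivl I H \<Longrightarrow> smooth_on_ivl I (\<lambda>s. F s * H s)"
  by (simp add: smooth_on_ivl_iff smooth_upto_mult)

lemma smooth_minus:
  fixes F :: "real \<Rightarrow> real"
  assumes "smooth_on_ivl I F" shows "smooth_on_ivl I (\<lambda>s. - F s)"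
  using smooth_mult[OF smooth_const[of "- 1"] assms] by simp

lemma smooth_inverse:
  fixes F :: "real \<Rightarrow> real"
  shows "smooth_on_ivl I F \<Longrightarrow> (\<And>u. u \<in> I \<Longrightarrow> F u \<noteq> 0) \<Longrightarrow> smooth_on_ivl I (\<lambda>s. inverse (F s))"
  by (simp add: smooth_on_ivl_iff smooth_upto_inverse)

lemma smooth_ivl_deriv: "smooth_on_ivl I F \<Longrightarrow> smooth_on_ivl I (ivl_deriv I F)"
  unfolding smooth_on_ivl_iff using smooth_upto_Suc by blast

lemma smooth_differentiable:
  "smooth_on_ivl I F \<Longrightarrow> u \<in> I \<Longrightarrow> F differentiable (at u within I)"
  unfolding smooth_on_ivl_iff using smooth_upto_Suc by blast

lemma smooth_has_ivl_deriv:
  "smooth_on_ivl I F \<Longrightarrow> u \<in> I \<Longrightarrow>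
    (F has_vector_derivative ivl_deriv I F u) (at u within I)"
  by (simp add: ivl_deriv_works smooth_differentiable)

lemma smooth_continuous_on: "smooth_on_ivl I F \<Longrightarrow> continuous_on I F"
  unfolding continuous_on_eq_continuous_within
  using smooth_differentiable differentiable_imp_continuous_within by blast

lemma ivl_deriv_zero_constant:
  assumes "\<And>s. s \<in> I \<Longrightarrow> (F has_vector_derivative 0) (at s within I)"
  obtains c where "\<And>s. s \<in> I \<Longrightarrow> F s = c"
  using has_vector_derivative_zero_constant[of I F] assms ivl is_interval_convex by blast

end

section \<open>Partial derivatives on the parameter rectangle\<close>

lemma pd_1: "pd I J 1 F u v = ivl_deriv I (\<lambda>s. F s v) u"
  and pd_2: "pd I J 2 F u v = ivl_deriv J (\<lambda>s. F u s) v"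
  by (simp_all add: pd_def)

text \<open>Needed because the factor \<open>\<lambda>\<close> turns out to depend on
  \<open>u\<close> alone. Each iterated partial derivative is again a function of \<open>u\<close>
  only, or zero once \<open>v\<close> has been used.\<close>

lemma smooth_on_rect_fst:
  fixes \<phi> :: "real \<Rightarrow> 'a :: real_normed_vector"
  assumes "nondegenerate_interval I" "nondegenerate_interval J" "smooth_on_ivl I \<phi>"
  shows "smooth_on_rect I J (\<lambda>u v. \<phi> u)"
proof -
  interpret I: nondegenerate_interval I by fact
  interpret J: nondegenerate_interval J by fact
  \<comment> \<open>Agreement is claimed on the rectangle only, since \<open>ivl_deriv\<close> is
    not controlled outside the parameter interval.\<close>
  have ex: "\<exists>H. smooth_on_ivl I H \<and> (\<forall>u\<in>I. \<forall>v\<in>J. foldr (pd I J) ks (\<lambda>u v. \<phi> u) u v = H u)" for ks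
  proof (induction ks)
    case Nil
    then show ?case using assms(3) by auto
  next
    case (Cons k ks)
    then obtain H where H: "smooth_on_ivl I H"
      "\<And>u v. u \<in> I \<Longrightarrow> v \<in> J \<Longrightarrow> foldr (pd I J) ks (\<lambda>u v. \<phi> u) u v = H u" by blast
    show ?case
    proof (cases "k = 1")
      case True
      have "ivl_deriv I (\<lambda>s. foldr (pd I J) ks (\<lambda>u v. \<phi> u) s v) u = ivl_deriv I H u"
        if "u \<in> I" "v \<in> J" for u v
        by (rule I.ivl_deriv_cong) (use that H(2) in auto)
      then show ?thesis using True I.smooth_ivl_deriv[OF H(1)]
        by (intro exI[of _ "ivl_deriv I H"]) (auto simp: pd_1)
    next
      case False
      have "ivl_deriv J (\<lambda>s. foldr (pd I J) ks (\<lambda>u v. \<phi> u) u s) v = 0" if "u \<in> I" "v \<in> J" for u v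
        by (rule J.ivl_deriv_eqI[where H = "\<lambda>_. H u"]) (use that H(2) in auto)
      moreover have "k = 2" using False exhaust_2 by blast
      ultimately show ?thesis using I.smooth_const[of 0]
        by (intro exI[of _ "\<lambda>_. 0"]) (auto simp: pd_2)
    qed
  qed
  show ?thesis unfolding smooth_on_rect_def Let_def
  proof (intro allI conjI ballI)
    fix ks
    obtain H where H: "smooth_on_ivl I H"
      "\<And>u v. u \<in> I \<Longrightarrow> v \<in> J \<Longrightarrow> foldr (pd I J) ks (\<lambda>u v. \<phi> u) u v = H u" using ex by blast
    have "continuous_on (I \<times> J) (\<lambda>p. H (fst p))"
      by (rule continuous_on_compose2[OF I.smooth_continuous_on[OF H(1)]]) (auto intro: continuous_intros)
    then show "continuous_on (I \<times> J) (\<lambda>(u, v). foldr (pd I J) ks (\<lambda>u v. \<phi> u) u v)"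
      using H(2) by (auto cong: continuous_on_cong_simp simp: case_prod_beta elim!: continuous_on_eq)
    fix u v assume uv: "u \<in> I" "v \<in> J"
    show "(\<lambda>s. foldr (pd I J) ks (\<lambda>u v. \<phi> u) s v) differentiable (at u within I)"
      by (rule I.differentiable_cong_on[OF uv(1) H(2)[OF _ uv(2)] I.smooth_differentiable[OF H(1) uv(1)]])
    show "(\<lambda>s. foldr (pd I J) ks (\<lambda>u v. \<phi> u) u s) differentiable (at v within J)"
      by (rule J.differentiable_cong_on[OF uv(2) H(2)[OF uv(1)]]) auto
  qed
qed

section \<open>Bivectors\<close>

lemma has_vector_derivative_scaleR_combination:
  assumes "(F has_vector_derivative F') (at u within S)" "(H has_vector_derivative H') (at u within S)"
  shows "((\<lambda>s. F s *\<^sub>R a + H s *\<^sub>R b) has_vector_derivative F' *\<^sub>R a + H' *\<^sub>R b) (at u within S)"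
  by (intro has_vector_derivative_add bounded_linear.has_vector_derivative[OF bounded_linear_scaleR_left] assms)

lemma bounded_bilinear_wedge: "bounded_bilinear wedge"
  unfolding bilinear_conv_bounded_bilinear[symmetric] bilinear_def
  by (auto intro!: linearI simp: wedge_def vec_eq_iff algebra_simps)

interpretation wedge: bounded_bilinear wedge
  by (rule bounded_bilinear_wedge)

lemma wedge_self [simp]: "wedge a a = 0"
  by (simp add: wedge_def vec_eq_iff)

lemma wedge_commute: "wedge a b = - wedge b a"
  by (simp add: wedge_def vec_eq_iff)

text \<open>The matrix of \<open>wedge a b\<close> is a b^T - b a^T, so testing it against two
  vectors of an orthonormal frame reads off a coefficient. The Euclidean product serves here, as
  only coefficients are compared.\<close>

lemma inner_wedge_mult:
  "c \<bullet> (wedge a b *v d) = (c \<bullet> a) * (b \<bullet> d) - (c \<bullet> b) * (a \<bullet> d)"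
  by (simp add: wedge_def inner_vec_def matrix_vector_mult_def sum_4 algebra_simps)

text \<open>The matrix \<open>A\<close> with these rows is orthogonal, hence invertible, and
  \<open>A *v w = 0\<close>.\<close>

lemma orthonormal_4_eq_0:
  fixes a b c d w :: "real ^ 4"
  assumes "a \<bullet> a = 1" "b \<bullet> b = 1" "c \<bullet> c = 1" "d \<bullet> d = 1"
    and "a \<bullet> b = 0" "a \<bullet> c = 0" "a \<bullet> d = 0" "b \<bullet> c = 0" "b \<bullet> d = 0" "c \<bullet> d = 0"
    and "a \<bullet> w = 0" "b \<bullet> w = 0" "c \<bullet> w = 0" "d \<bullet> w = 0"
  shows "w = 0"
proof -
  define A :: "real ^ 4 ^ 4" where "A = (\<chi> i. if i = 1 then a else if i = 2 then b else if i = 3 then c else d)"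
  have A: "A $ 1 = a" "A $ 2 = b" "A $ 3 = c" "A $ 4 = d"
    by (simp_all add: A_def)
  have "(A ** transpose A) $ i $ j = A $ i \<bullet> A $ j" for i j
    by (simp add: matrix_matrix_mult_def transpose_def inner_vec_def)
  then have "A ** transpose A = mat 1"
    using assms by (auto simp: vec_eq_iff forall_4 A mat_def inner_commute)
  then have "transpose A ** A = mat 1"
    by (simp add: matrix_left_right_inverse)
  moreover have "A *v w = 0"
    using assms by (simp add: vec_eq_iff forall_4 matrix_vector_mul_component A)
  ultimately show "w = 0"
    by (metis matrix_vector_mul_assoc matrix_vector_mul_lid matrix_vector_mult_0_right)
qed

lemma span_ee_123_nth_4:
  assumes "w \<in> span {ee 1, ee 2, ee 3}" shows "w $ 4 = 0"
  using assms by (induction rule: span_induct_alt) (auto simp: ee_def axis_def)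

text \<open>One argument in the spacelike hyperplane suffices, so everything about the spherical
  curve can be computed with the Euclidean product.\<close>

lemma mink_eq_inner: "a $ 4 = 0 \<Longrightarrow> mink a b = a \<bullet> b"
  by (simp add: mink_def inner_vec_def sum_4)

section \<open>The Laplacian of the Gauss map\<close>

lemma flat_deriv_frame_x: "flat_deriv I J frame_x F u v = pd I J 1 F u v"
  by (simp add: flat_deriv_def frame_x_def sum_2 axis_def)

lemma flat_deriv_frame_y: "flat_deriv I J (frame_y f) F u v = (1 / f u) *\<^sub>R pd I J 2 F u v"
  by (simp add: flat_deriv_def frame_y_def sum_2 axis_def)

section \<open>The surface and the orthonormal frame along the spherical curve\<close>

locale elliptic_meridian_surface =
  I: nondegenerate_interval I + J: nondegenerate_interval J for I J :: "real set" +
  fixes f g :: "real \<Rightarrow> real" and l n :: "real \<Rightarrow> real ^ 4"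
  assumes smooth_f: "smooth_on_ivl I f" and smooth_g: "smooth_on_ivl I g"
    and f_pos: "u \<in> I \<Longrightarrow> f u > 0"
    and unit_speed: "u \<in> I \<Longrightarrow> (ivl_deriv I f u)\<^sup>2 - (ivl_deriv I g u)\<^sup>2 = 1"
    and smooth_l: "smooth_on_ivl J l"
    and l_sphere: "v \<in> J \<Longrightarrow> l v \<in> unit_sphere2"
    and arc_length: "v \<in> J \<Longrightarrow> mink (ivl_deriv J l v) (ivl_deriv J l v) = 1"
    and normal: "spherical_normal J l n"
begin

abbreviation "f1 \<equiv> ivl_deriv I f"
abbreviation "f2 \<equiv> ivl_deriv I f1"
abbreviation "f3 \<equiv> ivl_deriv I f2"
abbreviation "g1 \<equiv> ivl_deriv I g"
abbreviation "g2 \<equiv> ivl_deriv I g1"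
abbreviation "g3 \<equiv> ivl_deriv I g2"
abbreviation "l1 \<equiv> ivl_deriv J l"
abbreviation "l2 \<equiv> ivl_deriv J l1"
abbreviation "l3 \<equiv> ivl_deriv J l2"
abbreviation "z \<equiv> meridian_surface f g l"
abbreviation "\<Gamma> \<equiv> gauss_map I J z frame_x (frame_y f)"

lemmas smooth_fg = smooth_f smooth_g smooth_f[THEN I.smooth_ivl_deriv] smooth_g[THEN I.smooth_ivl_deriv]
  smooth_f[THEN I.smooth_ivl_deriv, THEN I.smooth_ivl_deriv]
  smooth_g[THEN I.smooth_ivl_deriv, THEN I.smooth_ivl_deriv]

lemmas deriv_fg = smooth_fg[THEN I.smooth_has_ivl_deriv]

lemmas smooth_l12 = smooth_l smooth_l[THEN J.smooth_ivl_deriv]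
  smooth_l[THEN J.smooth_ivl_deriv, THEN J.smooth_ivl_deriv]

lemmas deriv_l = smooth_l12[THEN J.smooth_has_ivl_deriv]

lemma f_nonzero: "u \<in> I \<Longrightarrow> f u \<noteq> 0"
  using f_pos by force

text \<open>The fourth coordinate of \<open>l\<close> is constantly zero, so differentiating it,
  once for \<open>l1\<close> and again for \<open>l2\<close>, gives zero.\<close>

lemma l_nth_4:
  assumes "v \<in> J" shows "l v $ 4 = 0" "l1 v $ 4 = 0" "l2 v $ 4 = 0" "n v $ 4 = 0"
proof -
  have 0: "l v $ 4 = 0" if "v \<in> J" for v
    using l_sphere[OF that] span_ee_123_nth_4 by (auto simp: unit_sphere2_def)
  have 1: "l1 v $ 4 = 0" if v: "v \<in> J" for v
    using J.ivl_deriv_eqI[OF v 0 has_vector_derivative_const]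
      J.ivl_deriv_eqI[OF v refl bounded_linear.has_vector_derivative[OF bounded_linear_vec_nth deriv_l(1)[OF v]], of 4]
    by simp
  show "l v $ 4 = 0" "l1 v $ 4 = 0"
    using 0 1 assms by auto
  show "l2 v $ 4 = 0"
    using J.ivl_deriv_eqI[OF assms 1 has_vector_derivative_const]
      J.ivl_deriv_eqI[OF assms refl bounded_linear.has_vector_derivative[OF bounded_linear_vec_nth deriv_l(2)[OF assms]], of 4]
    by simp
  show "n v $ 4 = 0"
    using normal assms span_ee_123_nth_4 by (auto simp: spherical_normal_def)
qed

lemma inner_ee_4: "ee 4 \<bullet> w = w $ 4" "w \<bullet> ee 4 = w $ 4"
  by (simp_all add: ee_def inner_axis inner_axis')

text \<open>The relations with \<open>l1\<close> and \<open>l2\<close> come from differentiating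
  <l,l> = 1, <l1,l1> = 1 and <l,l1> = 0 along \<open>J\<close>.\<close>

lemma l_inner:
  assumes "v \<in> J"
  shows "l v \<bullet> l v = 1" "l v \<bullet> l1 v = 0" "l1 v \<bullet> l1 v = 1" "l1 v \<bullet> l2 v = 0" "l v \<bullet> l2 v = - 1"
    "n v \<bullet> n v = 1" "n v \<bullet> l v = 0" "n v \<bullet> l1 v = 0"
proof -
  note D = bounded_bilinear.has_vector_derivative[OF bounded_bilinear_inner]
  note D0 = J.ivl_deriv_eqI[OF assms _ has_vector_derivative_const]
  have 0: "l v \<bullet> l v = 1" if "v \<in> J" for v
    using l_sphere[OF that] by (auto simp: unit_sphere2_def mink_eq_inner l_nth_4[OF that])
  have 1: "l1 v \<bullet> l1 v = 1" if "v \<in> J" for v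
    using arc_length[OF that] by (auto simp: mink_eq_inner l_nth_4[OF that])
  have 2: "l v \<bullet> l1 v = 0" if v: "v \<in> J" for v
    using J.ivl_deriv_eqI[OF v refl D[OF deriv_l(1,1)[OF v]]]
      J.ivl_deriv_eqI[OF v 0 has_vector_derivative_const] by (simp add: inner_commute)
  show "l v \<bullet> l v = 1" "l1 v \<bullet> l1 v = 1" "l v \<bullet> l1 v = 0"
    using assms 0 1 2 by auto
  show "l1 v \<bullet> l2 v = 0"
    using J.ivl_deriv_eqI[OF assms refl D[OF deriv_l(2,2)[OF assms]]] D0[OF 1]
    by (simp add: inner_commute)
  show "l v \<bullet> l2 v = - 1"
    using J.ivl_deriv_eqI[OF assms refl D[OF deriv_l(1,2)[OF assms]]] D0[OF 2] 1[OF assms]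
    by simp
  show "n v \<bullet> n v = 1" "n v \<bullet> l v = 0" "n v \<bullet> l1 v = 0"
    using normal assms by (auto simp: spherical_normal_def mink_eq_inner l_nth_4)
qed

lemma spherical_curvature_eq: "v \<in> J \<Longrightarrow> spherical_curvature J l n v = l2 v \<bullet> n v"
  by (simp add: spherical_curvature_def mink_eq_inner l_nth_4)

text \<open>The Frenet equation t' = kappa n - l for a great circle: \<open>l2 v + l v\<close> is
  orthogonal to all four frame vectors.\<close>

lemma l2_eq:
  assumes "v \<in> J" "spherical_curvature J l n v = 0"
  shows "l2 v = - l v"
proof -
  note L = l_inner[OF assms(1)] l_nth_4[OF assms(1)]
  have "l2 v + l v = 0"
    by (rule orthonormal_4_eq_0[of "l v" "l1 v" "n v" "ee 4"])
      (use L assms spherical_curvature_eq[OF assms(1)] in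
        \<open>auto simp: inner_ee_4 inner_add_right inner_commute, simp_all add: ee_def\<close>)
  then show ?thesis by (simp add: eq_neg_iff_add_eq_0)
qed

section \<open>First fundamental form and Levi-Civita connection\<close>

lemma pd_1_z:
  assumes "u \<in> I" shows "pd I J 1 z u v = f1 u *\<^sub>R l v + g1 u *\<^sub>R ee 4"
proof -
  have "((\<lambda>s. z s v) has_vector_derivative f1 u *\<^sub>R l v + g1 u *\<^sub>R ee 4) (at u within I)"
    unfolding meridian_surface_def
    by (rule has_vector_derivative_scaleR_combination[OF deriv_fg(1,2)[OF assms]])
  then show ?thesis
    unfolding pd_1 by (rule I.ivl_deriv_eqI[OF assms refl])
qed

lemma pd_2_z:
  assumes "v \<in> J" shows "pd I J 2 z u v = f u *\<^sub>R l1 v"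
proof -
  have "((\<lambda>s. z u s) has_vector_derivative f u *\<^sub>R l1 v + 0) (at v within J)"
    unfolding meridian_surface_def
    by (intro has_vector_derivative_add has_vector_derivative_const
        bounded_linear.has_vector_derivative[OF bounded_linear_scaleR_right] deriv_l(1)[OF assms])
  then show ?thesis
    unfolding pd_2 by (auto dest: J.ivl_deriv_eqI[OF assms refl])
qed

lemma first_form_eq:
  assumes "u \<in> I" "v \<in> J"
  shows "first_form I J z u v = (\<chi> i j. if i = j then if i = 1 then 1 else (f u)\<^sup>2 else 0)"
proof -
  have mink: "mink (a *\<^sub>R p + b *\<^sub>R ee 4) (c *\<^sub>R q + d *\<^sub>R ee 4) = a * c * (p \<bullet> q) - b * d"
    if "p $ 4 = 0" "q $ 4 = 0" for a b c d p q
    using that by (simp add: mink_def inner_vec_def sum_4 ee_def axis_def algebra_simps)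
  note L = l_inner[OF assms(2)] l_nth_4[OF assms(2)]
  have "mink (pd I J 1 z u v) (pd I J 1 z u v) = 1"
    using unit_speed[OF assms(1)] by (simp add: pd_1_z[OF assms(1)] mink L power2_eq_square)
  moreover have "mink (pd I J 1 z u v) (pd I J 2 z u v) = 0" "mink (pd I J 2 z u v) (pd I J 1 z u v) = 0"
      "mink (pd I J 2 z u v) (pd I J 2 z u v) = (f u)\<^sup>2"
    using mink[of "l v" "l1 v" "f1 u" "g1 u" "f u" 0] mink[of "l1 v" "l v" "f u" 0 "f1 u" "g1 u"]
      mink[of "l1 v" "l1 v" "f u" 0 "f u" 0]
    by (simp_all add: pd_1_z[OF assms(1)] pd_2_z[OF assms(2)] L inner_commute power2_eq_square)
  ultimately show ?thesis
    by (simp add: first_form_def vec_eq_iff forall_2)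
qed

lemma matrix_inv_first_form:
  assumes "u \<in> I" "v \<in> J"
  shows "matrix_inv (first_form I J z u v) =
    (\<chi> i j. if i = j then if i = 1 then 1 else 1 / (f u)\<^sup>2 else 0)" (is "_ = ?B")
proof -
  let ?A = "first_form I J z u v"
  have AB: "?A ** ?B = mat 1" "?B ** ?A = mat 1"
    using f_nonzero[OF assms(1)]
    by (simp_all add: first_form_eq[OF assms] matrix_matrix_mult_def vec_eq_iff forall_2 sum_2 mat_def)
  \<comment> \<open>\<open>matrix_inv\<close> is a choice among two-sided inverses;
    \<open>?B\<close> shows that there is one, and uniqueness then identifies the choice.\<close>
  then have inv: "?A ** matrix_inv ?A = mat 1"
    unfolding matrix_inv_def by (rule someI2[where Q = "\<lambda>M. ?A ** M = mat 1", OF conjI]) simp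
  have "matrix_inv ?A = (?B ** ?A) ** matrix_inv ?A"
    by (simp only: AB matrix_mul_lid)
  also have "\<dots> = ?B"
    by (simp only: inv matrix_mul_rid matrix_mul_assoc[symmetric])
  finally show ?thesis .
qed

lemma pd_first_form:
  assumes "u \<in> I" "v \<in> J"
  shows "pd I J m (\<lambda>u v. first_form I J z u v $ i $ j) u v =
    (if m = 1 \<and> i = 2 \<and> j = 2 then 2 * f u * f1 u else 0)"
proof (cases "m = 1")
  case True
  have "((\<lambda>s. if i = j then if i = 1 then 1 else (f s)\<^sup>2 else 0) has_vector_derivative
      (if i = 2 \<and> j = 2 then 2 * f u * f1 u else 0)) (at u within I)"
    using exhaust_2[of i] exhaust_2[of j]
    by (auto simp: power2_eq_square intro!: derivative_eq_intros deriv_fg[OF assms(1)])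
  from I.ivl_deriv_eqI[OF assms(1) _ this] show ?thesis
    using True by (simp add: pd_def first_form_eq assms)
next
  case False
  have "ivl_deriv J (\<lambda>s. first_form I J z u s $ i $ j) v = 0"
    by (rule J.ivl_deriv_eqI[OF assms(2) _ has_vector_derivative_const]) (simp add: first_form_eq assms)
  with False show ?thesis by (simp add: pd_def)
qed

text \<open>The \<open>u\<close>-curves are unit speed geodesics, because the metric coefficients
  with an index 1 are constant.\<close>

lemma levi_civita_frame_x:
  assumes "u \<in> I" "v \<in> J"
  shows "levi_civita I J z frame_x frame_x u v = 0"
proof -
  have "pd I J 1 (\<lambda>u v. frame_x u v $ k) u v = 0" for k
    unfolding pd_def frame_x_def
    by (simp add: I.ivl_deriv_eqI[OF assms(1) refl has_vector_derivative_const])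
  moreover have "christoffel I J z k 1 1 u v = 0" for k
    by (simp add: christoffel_def pd_first_form[OF assms])
  ultimately show ?thesis
    by (simp add: levi_civita_def flat_deriv_frame_x vec_eq_iff sum_2) (simp add: frame_x_def axis_def)
qed

text \<open>Of the Christoffel symbols with lower indices 2, 2 only the one with upper index 1
  survives. It equals - f f' and is scaled by the square of 1/f.\<close>

lemma levi_civita_frame_y:
  assumes "u \<in> I" "v \<in> J"
  shows "levi_civita I J z (frame_y f) (frame_y f) u v = (- f1 u / f u) *\<^sub>R frame_x u v"
proof -
  have "pd I J 2 (\<lambda>u v. frame_y f u v $ k) u v = 0" for k
    unfolding pd_def frame_y_def
    by (simp add: J.ivl_deriv_eqI[OF assms(2) refl has_vector_derivative_const])
  moreover have "christoffel I J z k 2 2 u v = (if k = 1 then - f u * f1 u else 0)" for k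
    using exhaust_2[of k]
    by (auto simp: christoffel_def pd_first_form[OF assms] matrix_inv_first_form[OF assms] sum_2)
  moreover have "frame_y f u v $ 1 = 0" "frame_y f u v $ 2 = 1 / f u"
    "frame_x u v $ 1 = 1" "frame_x u v $ 2 = 0"
    by (simp_all add: frame_x_def frame_y_def axis_def)
  ultimately show ?thesis
    using f_nonzero[OF assms(1)]
    by (simp add: levi_civita_def flat_deriv_frame_y vec_eq_iff sum_2 forall_2)
qed

section \<open>The Gauss map, its Laplacian and their components\<close>

lemma gauss_map_eq:
  assumes "u \<in> I" "v \<in> J"
  shows "\<Gamma> u v = wedge (f1 u *\<^sub>R l v + g1 u *\<^sub>R ee 4) (l1 v)"
proof -
  have "flat_deriv I J frame_x z u v = f1 u *\<^sub>R l v + g1 u *\<^sub>R ee 4"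
    by (simp only: flat_deriv_frame_x pd_1_z[OF assms(1)])
  moreover have "flat_deriv I J (frame_y f) z u v = l1 v"
    using f_nonzero[OF assms(1)] by (simp add: flat_deriv_frame_y pd_2_z[OF assms(2)])
  ultimately show ?thesis
    by (simp only: gauss_map_def)
qed

text \<open>The middle term comes from the covariant derivative of y along y. The factor 1/f of y
  does not depend on \<open>v\<close>, so it passes through the second \<open>v\<close>-derivative
  and appears squared.\<close>

lemma laplacian_gauss_map:
  assumes "u \<in> I" "v \<in> J"
  shows "laplacian I J z frame_x (frame_y f) \<Gamma> u v =
    - wedge (f3 u *\<^sub>R l v + g3 u *\<^sub>R ee 4) (l1 v)
    - (f1 u / f u) *\<^sub>R wedge (f2 u *\<^sub>R l v + g2 u *\<^sub>R ee 4) (l1 v)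
    - (1 / (f u)\<^sup>2) *\<^sub>R (f1 u *\<^sub>R wedge (l1 v) (l2 v)
        + wedge (f1 u *\<^sub>R l v + g1 u *\<^sub>R ee 4) (l3 v))"
proof -
  note D = wedge.has_vector_derivative[OF
      has_vector_derivative_scaleR_combination has_vector_derivative_const]
  have u: "pd I J 1 \<Gamma> u v = wedge (f2 u *\<^sub>R l v + g2 u *\<^sub>R ee 4) (l1 v)"
    if "u \<in> I" "v \<in> J" for u v
    using I.ivl_deriv_eqI[OF that(1) gauss_map_eq[OF _ that(2)] D[OF deriv_fg(3,4)[OF that(1)]]]
    by (simp add: pd_1 wedge.zero_right)
  have uu: "pd I J 1 (pd I J 1 \<Gamma>) u v = wedge (f3 u *\<^sub>R l v + g3 u *\<^sub>R ee 4) (l1 v)"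
    unfolding pd_1[of _ _ "pd I J 1 \<Gamma>"]
    using I.ivl_deriv_eqI[OF assms(1) u[OF _ assms(2)] D[OF deriv_fg(5,6)[OF assms(1)]]]
    by (simp add: wedge.zero_right)
  have E: "((\<lambda>s. f1 u *\<^sub>R l s + g1 u *\<^sub>R ee 4) has_vector_derivative f1 u *\<^sub>R l1 v) (at v within J)"
    if "v \<in> J" for u v
    by (auto intro!: derivative_eq_intros deriv_l that)
  \<comment> \<open>The other term of the product rule is a multiple of
    \<open>wedge (l1 v) (l1 v)\<close> and vanishes.\<close>
  have v: "pd I J 2 \<Gamma> u v = wedge (f1 u *\<^sub>R l v + g1 u *\<^sub>R ee 4) (l2 v)"
    if "u \<in> I" "v \<in> J" for u v
    using J.ivl_deriv_eqI[OF that(2) gauss_map_eq[OF that(1)]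
        wedge.has_vector_derivative[OF E[OF that(2)] deriv_l(2)[OF that(2)]]]
    by (simp add: pd_2 wedge.scaleR_left)
  have vv: "pd I J 2 (\<lambda>u v. (1 / f u) *\<^sub>R pd I J 2 \<Gamma> u v) u v =
      (1 / f u) *\<^sub>R (wedge (f1 u *\<^sub>R l v + g1 u *\<^sub>R ee 4) (l3 v) + f1 u *\<^sub>R wedge (l1 v) (l2 v))"
  proof -
    have "ivl_deriv J (\<lambda>s. (1 / f u) *\<^sub>R pd I J 2 \<Gamma> u s) v = 
      (1 / f u) *\<^sub>R (wedge (f1 u *\<^sub>R l v + g1 u *\<^sub>R ee 4) (l3 v) + f1 u *\<^sub>R wedge (l1 v) (l2 v))"
      using J.ivl_deriv_eqI[OF assms(2) _ bounded_linear.has_vector_derivative[OF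
        bounded_linear_scaleR_right
        wedge.has_vector_derivative[OF E[OF assms(2)] deriv_l(3)[OF assms(2)]]]]
      by (simp add: wedge.scaleR_left v assms)
    then show ?thesis by (simp add: pd_2)
  qed
  have "flat_deriv I J frame_x (flat_deriv I J frame_x \<Gamma>) u v = pd I J 1 (pd I J 1 \<Gamma>) u v"
    by (simp add: flat_deriv_frame_x[abs_def] flat_deriv_frame_x)
  moreover have "flat_deriv I J (frame_y f) (flat_deriv I J (frame_y f) \<Gamma>) u v =
      (1 / f u) *\<^sub>R pd I J 2 (\<lambda>u v. (1 / f u) *\<^sub>R pd I J 2 \<Gamma> u v) u v"
    by (simp add: flat_deriv_frame_y[abs_def] flat_deriv_frame_y)
  moreover have "flat_deriv I J (levi_civita I J z frame_x frame_x) \<Gamma> u v = 0"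
    by (simp add: flat_deriv_def levi_civita_frame_x[OF assms])
  moreover have "flat_deriv I J (levi_civita I J z (frame_y f) (frame_y f)) \<Gamma> u v =
      (- f1 u / f u) *\<^sub>R pd I J 1 \<Gamma> u v"
    by (simp add: flat_deriv_def levi_civita_frame_y[OF assms] sum_2) (simp add: frame_x_def axis_def)
  ultimately show ?thesis
    unfolding laplacian_def uu vv u[OF assms]
    by (simp add: power2_eq_square add.commute)
qed

text \<open>Applying both bivectors to \<open>l1 v\<close> and pairing with \<open>l v\<close> and
  \<open>ee 4\<close> recovers the coefficients.\<close>

lemma wedge_combination_l1_eq_iff:
  assumes "v \<in> J"
  shows "wedge (a *\<^sub>R l v + b *\<^sub>R ee 4) (l1 v) = wedge (a' *\<^sub>R l v + b' *\<^sub>R ee 4) (l1 v)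
    \<longleftrightarrow> a = a' \<and> b = b'"
proof
  assume eq: "wedge (a *\<^sub>R l v + b *\<^sub>R ee 4) (l1 v) = wedge (a' *\<^sub>R l v + b' *\<^sub>R ee 4) (l1 v)"
  have "l v \<bullet> (wedge (c *\<^sub>R l v + d *\<^sub>R ee 4) (l1 v) *v l1 v) = c"
    "ee 4 \<bullet> (wedge (c *\<^sub>R l v + d *\<^sub>R ee 4) (l1 v) *v l1 v) = d" for c d
    unfolding inner_wedge_mult using l_inner[OF assms] l_nth_4[OF assms]
    by (simp_all add: inner_ee_4 inner_add_left inner_add_right) (simp add: ee_def)
  then show "a = a' \<and> b = b'" using eq by metis
qed simp

text \<open>Pairing with \<open>l1 v\<close> and \<open>n v\<close> kills each bivector that has a
  factor in the span of \<open>l v\<close> and \<open>ee 4\<close>; only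
  \<open>wedge (l1 v) (l2 v)\<close> is left. For a given \<open>v\<close>, a single
  \<open>u\<close> is enough.\<close>

lemma curvature_zero_of_laplacian_eq:
  assumes uv: "u \<in> I" "v \<in> J"
    and eq: "laplacian I J z frame_x (frame_y f) \<Gamma> u v = c *\<^sub>R \<Gamma> u v"
  shows "spherical_curvature J l n v = 0"
proof -
  have L: "l1 v \<bullet> l v = 0" "l1 v \<bullet> n v = 0" "l v \<bullet> n v = 0" "ee 4 \<bullet> n v = 0" "l1 v \<bullet> ee 4 = 0"
    using l_inner[OF uv(2)] l_nth_4[OF uv(2)] by (simp_all add: inner_commute inner_ee_4)
  have "l1 v \<bullet> (laplacian I J z frame_x (frame_y f) \<Gamma> u v *v n v) = - (f1 u / (f u)\<^sup>2) * (l2 v \<bullet> n v)"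
    unfolding laplacian_gauss_map[OF uv]
    by (simp add: matrix_vector_mult_add_rdistrib matrix_vector_mult_diff_rdistrib
        scaleR_matrix_vector_assoc[symmetric] wedge.minus_left[symmetric] inner_add_left
        inner_add_right inner_diff_left inner_diff_right inner_wedge_mult L l_inner[OF uv(2)])
  moreover have "l1 v \<bullet> ((c *\<^sub>R \<Gamma> u v) *v n v) = 0"
    unfolding gauss_map_eq[OF uv]
    by (simp add: scaleR_matrix_vector_assoc[symmetric] inner_wedge_mult inner_add_left L)
  moreover have "(f1 u)\<^sup>2 > 0"
    using unit_speed[OF uv(1)] zero_le_power2[of "g1 u"] by linarith
  ultimately show ?thesis
    using eq f_nonzero[OF uv(1)] spherical_curvature_eq[OF uv(2)] by simp
qed

section \<open>The meridian curve\<close>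

text \<open>With \<open>f' = \<plusminus> cosh \<theta>\<close> and \<open>g' = sinh \<theta>\<close>, the function \<open>w\<close> is \<open>\<plusminus>\<theta>'\<close>.\<close>

definition "w u = f1 u * g2 u - g1 u * f2 u"
text \<open>The derivative of \<open>w\<close>, in which the products of \<open>f2\<close> and
  \<open>g2\<close> have cancelled.\<close>

definition "w1 u = f1 u * g3 u - g1 u * f3 u"
text \<open>Up to the sign of g', this is the quantity differentiated in the differential equation,
  but it is smooth across zeros of g' as well.\<close>

definition "p u = f u * w u"
definition "p1 u = f1 u * w u + f u * w1 u"

lemma f1_square: "u \<in> I \<Longrightarrow> (f1 u)\<^sup>2 = 1 + (g1 u)\<^sup>2"
  using unit_speed[of u] by simp

lemma sqrt_f1: "u \<in> I \<Longrightarrow> sqrt ((f1 u)\<^sup>2 - 1) = \<bar>g1 u\<bar>"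
  by (simp add: f1_square)

lemma f1_square_gt_1_iff: "u \<in> I \<Longrightarrow> (f1 u)\<^sup>2 > 1 \<longleftrightarrow> g1 u \<noteq> 0"
  by (simp add: f1_square)

text \<open>Differentiating f'^2 - g'^2 = 1 makes (f'', g'') Lorentz-orthogonal to (f', g'), hence a
  multiple of (g', f'); the factor is \<open>w\<close>.\<close>

lemma f2_g2_eq:
  assumes "u \<in> I" shows "f2 u = g1 u * w u" "g2 u = f1 u * w u"
proof -
  have "((\<lambda>s. f1 s * f1 s - g1 s * g1 s) has_vector_derivative
      (f1 u * f2 u + f2 u * f1 u) - (g1 u * g2 u + g2 u * g1 u)) (at u within I)"
    by (intro has_vector_derivative_diff has_vector_derivative_mult deriv_fg assms)
  then have "ivl_deriv I (\<lambda>s. f1 s * f1 s - g1 s * g1 s) u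
      = (f1 u * f2 u + f2 u * f1 u) - (g1 u * g2 u + g2 u * g1 u)"
    by (rule I.ivl_deriv_eqI[OF assms refl])
  moreover have "ivl_deriv I (\<lambda>s. f1 s * f1 s - g1 s * g1 s) u = 0"
    by (rule I.ivl_deriv_eqI[OF assms _ has_vector_derivative_const[of 1]])
      (use unit_speed in \<open>simp add: power2_eq_square\<close>)
  ultimately have "f1 u * f2 u = g1 u * g2 u" by simp
  then show "f2 u = g1 u * w u" "g2 u = f1 u * w u"
    using unit_speed[OF assms] unfolding w_def by algebra+
qed

lemma deriv_w: "u \<in> I \<Longrightarrow> (w has_vector_derivative w1 u) (at u within I)"
proof -
  assume u: "u \<in> I"
  have "((\<lambda>u. f1 u * g2 u - g1 u * f2 u) has_vector_derivative
      (f1 u * g3 u + f2 u * g2 u) - (g1 u * f3 u + g2 u * f2 u)) (at u within I)"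
    by (intro has_vector_derivative_diff has_vector_derivative_mult deriv_fg u)
  then show ?thesis by (simp add: w_def[abs_def] w1_def mult.commute)
qed

lemma deriv_p: "u \<in> I \<Longrightarrow> (p has_vector_derivative p1 u) (at u within I)"
  using has_vector_derivative_mult[OF deriv_fg(1) deriv_w, of u]
  by (simp add: p_def[abs_def] p1_def add.commute)

lemma f3_g3_eq:
  assumes "u \<in> I"
  shows "f3 u = f1 u * (w u)\<^sup>2 + g1 u * w1 u" "g3 u = g1 u * (w u)\<^sup>2 + f1 u * w1 u"
  using I.ivl_deriv_eqI[OF assms f2_g2_eq(1) has_vector_derivative_mult[OF deriv_fg(4) deriv_w]]
    I.ivl_deriv_eqI[OF assms f2_g2_eq(2) has_vector_derivative_mult[OF deriv_fg(3) deriv_w]]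
  by (simp_all add: assms f2_g2_eq power2_eq_square)

text \<open>Here a = f', b = g', h = f, r = 1/f, x = w, y = w'. Since a^2 - b^2 = 1, a times the
  first equation minus b times the second isolates c, and b times the first minus a times the second
  eliminates it.\<close>

lemma eliminate_factor_iff:
  fixes a b c r h x y :: real
  assumes "a\<^sup>2 = 1 + b\<^sup>2" "h * r = 1"
  shows "- (a * x\<^sup>2 + b * y) - a * r * (b * x) = c * a \<and>
      - (b * x\<^sup>2 + a * y) - a * r * (a * x) + r\<^sup>2 * b = c * b
    \<longleftrightarrow> c = - (x * x + (b * r) * (b * r)) \<and> h * (a * x + h * y) = a * b" (is "?L1 \<and> ?L2 \<longleftrightarrow> ?R1 \<and> ?R2")
proof
  assume "?L1 \<and> ?L2"
  then have 1: ?L1 and 2: ?L2 by auto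
  show "?R1 \<and> ?R2"
  proof
    show ?R1 using 1 2 assms by algebra
    show ?R2 using 1 2 assms by algebra
  qed
next
  assume "?R1 \<and> ?R2"
  then have 1: ?R1 and 2: ?R2 by auto
  have 3: "y = r * a * (r * b - x)" using 2 assms(2) by algebra
  show "?L1 \<and> ?L2"
  proof
    show ?L1 unfolding 3 1 by (simp add: algebra_simps power2_eq_square)
    show ?L2 unfolding 3 1 using assms by algebra
  qed
qed

lemma laplacian_eq_iff:
  assumes uv: "u \<in> I" "v \<in> J" and zero: "\<And>v. v \<in> J \<Longrightarrow> spherical_curvature J l n v = 0"
  shows "laplacian I J z frame_x (frame_y f) \<Gamma> u v = c *\<^sub>R \<Gamma> u v \<longleftrightarrow>
    c = - (w u * w u + (g1 u * inverse (f u)) * (g1 u * inverse (f u))) \<and> f u * p1 u = f1 u * g1 u"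
proof -
  let ?r = "inverse (f u)"
  let ?A = "- f3 u - f1 u * ?r * f2 u" and ?B = "- g3 u - f1 u * ?r * g2 u + ?r\<^sup>2 * g1 u"
  \<comment> \<open>A third derivative needs \<open>l2 = - l\<close> on the whole of
    \<open>J\<close>, not only at \<open>v\<close>.\<close>
  have "((\<lambda>s. - l s) has_vector_derivative - l1 v) (at v within J)"
    by (intro has_vector_derivative_minus deriv_l uv)
  then have l3: "l3 v = - l1 v"
    using J.ivl_deriv_eqI[OF uv(2), of l2 "\<lambda>s. - l s"] l2_eq zero by simp
  \<comment> \<open>The two contributions with 1/f^2 to the coefficient of
    \<open>wedge (l v) (l1 v)\<close> cancel; the one with g' survives in \<open>?B\<close>.\<close>
  have "laplacian I J z frame_x (frame_y f) \<Gamma> u v = wedge (?A *\<^sub>R l v + ?B *\<^sub>R ee 4) (l1 v)"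
    unfolding laplacian_gauss_map[OF uv] l3 l2_eq[OF uv(2) zero[OF uv(2)]]
    by (simp add: wedge.add_left wedge.diff_left wedge.minus_left wedge.scaleR_left wedge.minus_right wedge_commute[of "l1 v" "l v"]
        algebra_simps divide_inverse power_inverse)
  moreover have "c *\<^sub>R \<Gamma> u v = wedge ((c * f1 u) *\<^sub>R l v + (c * g1 u) *\<^sub>R ee 4) (l1 v)"
    by (simp add: gauss_map_eq[OF uv] wedge.add_left wedge.scaleR_left scaleR_add_right)
  ultimately have "laplacian I J z frame_x (frame_y f) \<Gamma> u v = c *\<^sub>R \<Gamma> u v \<longleftrightarrow> ?A = c * f1 u \<and> ?B = c * g1 u"
    by (simp only: wedge_combination_l1_eq_iff[OF uv(2)])
  also have "\<dots> \<longleftrightarrow> c = - (w u * w u + (g1 u * ?r) * (g1 u * ?r)) \<and> f u * p1 u = f1 u * g1 u"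
    unfolding p1_def f3_g3_eq[OF uv(1)] f2_g2_eq[OF uv(1)]
    by (rule eliminate_factor_iff[OF f1_square[OF uv(1)]]) (simp add: f_nonzero uv)
  finally show ?thesis .
qed

text \<open>Near \<open>u\<close> the sign \<open>e\<close> of g' is constant. Since f'' = g' w, the
  quotient in the equation is \<open>e * p\<close> there, and \<open>e\<close> factors out of the
  whole equation.\<close>

lemma meridian_ode_iff:
  assumes u: "u \<in> I" and nz: "g1 u \<noteq> 0"
  shows "meridian_ode I f u \<longleftrightarrow> f u * p1 u = f1 u * g1 u"
proof -
  define e where "e = sgn (g1 u)"
  have e: "e \<noteq> 0" "\<bar>g1 u\<bar> = e * g1 u" using nz by (auto simp: e_def sgn_if)
  have "continuous_on I g1" by (rule I.smooth_continuous_on[OF smooth_fg(4)])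
  \<comment> \<open>A deviation smaller than \<open>\<bar>g1 u\<bar>\<close> keeps \<open>g1\<close>
    from changing sign.\<close>
  then obtain d where d: "d > 0" "\<And>s. s \<in> I \<Longrightarrow> dist s u < d \<Longrightarrow> dist (g1 s) (g1 u) < \<bar>g1 u\<bar>"
    using u nz unfolding continuous_on_iff by (metis zero_less_abs_iff)
  have loc: "e * p s = f s * f2 s / sqrt ((f1 s)\<^sup>2 - 1)" if s: "s \<in> I" "dist s u < d" for s
  proof -
    have "g1 s \<noteq> 0" "e = sgn (g1 s)"
      using d(2)[OF s] by (auto simp: e_def sgn_if dist_real_def split: if_splits)
    then show ?thesis
      by (auto simp: sqrt_f1[OF s(1)] f2_g2_eq[OF s(1)] p_def sgn_if)
  qed
  have "((\<lambda>s. e * p s) has_vector_derivative e * p1 u) (at u within I)"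
    using bounded_linear.has_vector_derivative[OF bounded_linear_mult_right deriv_p[OF u]] .
  then have "((\<lambda>s. f s * f2 s / sqrt ((f1 s)\<^sup>2 - 1)) has_vector_derivative e * p1 u) (at u within I)"
    by (rule has_vector_derivative_transform_within[OF _ d(1) u loc])
  then have "ivl_deriv I (\<lambda>s. f s * f2 s / sqrt ((f1 s)\<^sup>2 - 1)) u = e * p1 u"
    by (rule I.ivl_deriv_eqI[OF u refl])
  then have "meridian_ode I f u \<longleftrightarrow> e * (f u * p1 u - f1 u * g1 u) = 0"
    unfolding meridian_ode_def by (simp add: sqrt_f1[OF u] e(2) algebra_simps)
  then show ?thesis using e(1) by simp
qed

text \<open>The differential equation says that \<open>(g', p)\<close> solves the linear system
  \<open>g'' = (f'/f) p\<close>, \<open>p' = (f'/f) g'\<close>, which has the first integrals \<open>(g' + p) / f\<close> and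
  \<open>(g' - p) f\<close>.\<close>

lemma zero_propagates:
  assumes ode: "\<And>u. u \<in> I \<Longrightarrow> f u * p1 u = f1 u * g1 u"
    and a: "a \<in> I" "g1 a = 0" "p a = 0" and u: "u \<in> I"
  shows "g1 u = 0 \<and> w u = 0"
proof -
  have "((\<lambda>s. (g1 s + p s) / f s) has_vector_derivative 0) (at s within I)"
    "((\<lambda>s. (g1 s - p s) * f s) has_vector_derivative 0) (at s within I)" if s: "s \<in> I" for s
  proof -
    note F = deriv_fg(1)[OF s] and G = deriv_fg(4)[OF s] and P = deriv_p[OF s]
    \<comment> \<open>The first identity makes the numerator of the quotient rule vanish, the second
      is the product rule set to zero.\<close>
    have *: "(g2 s + p1 s) * f s = (g1 s + p s) * f1 s" "(g2 s - p1 s) * f s + (g1 s - p s) * f1 s = 0"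
      using ode[OF s] by (simp_all add: f2_g2_eq[OF s] p_def algebra_simps)
    show "((\<lambda>s. (g1 s + p s) / f s) has_vector_derivative 0) (at s within I)"
      using DERIV_divide[of "\<lambda>s. g1 s + p s" "g2 s + p1 s" s I f "f1 s"]
        has_vector_derivative_add[OF G P] F f_nonzero[OF s] *
      by (simp add: has_real_derivative_iff_has_vector_derivative)
    show "((\<lambda>s. (g1 s - p s) * f s) has_vector_derivative 0) (at s within I)"
      using has_vector_derivative_mult[OF has_vector_derivative_diff[OF G P] F] *
      by (simp add: add.commute)
  qed
  note const = this
  obtain c where "\<And>s. s \<in> I \<Longrightarrow> (g1 s + p s) / f s = c"
    using I.ivl_deriv_zero_constant[OF const(1)] by blast
  moreover obtain d where "\<And>s. s \<in> I \<Longrightarrow> (g1 s - p s) * f s = d"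
    using I.ivl_deriv_zero_constant[OF const(2)] by blast
  ultimately have "(g1 u + p u) / f u = (g1 a + p a) / f a" "(g1 u - p u) * f u = (g1 a - p a) * f a"
    by (simp_all only: a(1) u)
  then have "g1 u + p u = 0" "g1 u - p u = 0"
    using a f_nonzero[OF u] by auto
  then show ?thesis using f_nonzero[OF u] by (auto simp: p_def)
qed

text \<open>Off the closure g' vanishes near \<open>u\<close>, so g'' and \<open>w\<close> vanish at
  \<open>u\<close> too. The zero data would then spread to \<open>a\<close>.\<close>

lemma nondegenerate_points_dense:
  assumes ode: "\<And>u. u \<in> I \<Longrightarrow> f u * p1 u = f1 u * g1 u"
    and a: "a \<in> I" "g1 a \<noteq> 0 \<or> w a \<noteq> 0"
  shows "I \<subseteq> closure {u \<in> I. (f1 u)\<^sup>2 > 1}"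
proof
  fix u assume u: "u \<in> I"
  show "u \<in> closure {u \<in> I. (f1 u)\<^sup>2 > 1}"
  proof (rule ccontr)
    assume "u \<notin> closure {u \<in> I. (f1 u)\<^sup>2 > 1}"
    then obtain d where d: "d > 0" "\<And>s. s \<in> I \<Longrightarrow> dist s u < d \<Longrightarrow> g1 s = 0"
      unfolding closure_approachable using f1_square_gt_1_iff by auto
    have "(g1 has_vector_derivative 0) (at u within I)"
      by (rule has_vector_derivative_transform_within[OF has_vector_derivative_const[of 0] d(1) u])
        (simp add: d(2))
    then have "g2 u = 0" by (rule I.ivl_deriv_eqI[OF u refl])
    moreover have "g1 u = 0" using d u by simp
    ultimately have "w u = 0" by (simp add: w_def)
    with zero_propagates[OF ode u \<open>g1 u = 0\<close> _ a(1)] a(2) show False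
      by (simp add: p_def)
  qed
qed

text \<open>Freed of the square root, the equation is a closed condition on \<open>I\<close>, so it
  passes from a dense set to all points, including zeros of g'.\<close>

lemma ode_everywhere:
  assumes dense: "I \<subseteq> closure {u \<in> I. (f1 u)\<^sup>2 > 1}"
    and ode: "\<And>u. u \<in> I \<Longrightarrow> g1 u \<noteq> 0 \<Longrightarrow> f u * p1 u = f1 u * g1 u" and u: "u \<in> I"
  shows "f u * p1 u = f1 u * g1 u"
proof -
  let ?E = "\<lambda>u. f u * p1 u - f1 u * g1 u"
  note C = smooth_fg[THEN I.smooth_continuous_on]
    smooth_fg(5,6)[THEN I.smooth_ivl_deriv, THEN I.smooth_continuous_on]
  have "continuous_on I ?E"
    unfolding p1_def w_def w1_def by (intro continuous_intros C)
  then obtain T where T: "closed T" "{u \<in> I. ?E u = 0} = I \<inter> T"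
    using continuous_closedin_preimage_constant[of I ?E 0] by (auto simp: closedin_closed)
  have "{u \<in> I. (f1 u)\<^sup>2 > 1} \<subseteq> T"
    using T(2) ode f1_square_gt_1_iff by auto
  then have "u \<in> T"
    using dense u T(1) closure_minimal by blast
  then show ?thesis using T(2) u by auto
qed

end

section \<open>The two directions of the equivalence\<close>

theorem theorem5p1:
  fixes I J :: "real set" and f g :: "real \<Rightarrow> real" and l n :: "real \<Rightarrow> real ^ 4"
  assumes "is_interval I" and "interior I \<noteq> {}"
    and "is_interval J" and "interior J \<noteq> {}"
    and "smooth_on_ivl I f" and "smooth_on_ivl I g"
    and "\<forall>u\<in>I. f u > 0"
    and "\<forall>u\<in>I. (ivl_deriv I f u)\<^sup>2 - (ivl_deriv I g u)\<^sup>2 = 1"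
    and "smooth_on_ivl J l"
    and "\<forall>v\<in>J. l v \<in> unit_sphere2"
    and "\<forall>v\<in>J. mink (ivl_deriv J l v) (ivl_deriv J l v) = 1"
    and "spherical_normal J l n"
  shows "pointwise_1_type_first_kind I J (meridian_surface f g l) frame_x (frame_y f) \<longleftrightarrow>
    (\<forall>v\<in>J. spherical_curvature J l n v = 0) \<and> meridian_from_ode I f g"
proof -
  interpret elliptic_meridian_surface I J f g l n
    using assms by unfold_locales auto
  \<comment> \<open>The only possible factor, as forced by \<open>laplacian_eq_iff\<close>.\<close>
  let ?\<phi> = "\<lambda>u. - (w u * w u + (g1 u * inverse (f u)) * (g1 u * inverse (f u)))"
  let ?L = "laplacian I J z frame_x (frame_y f) \<Gamma>"
  obtain u0 v0 where u0: "u0 \<in> I" and v0: "v0 \<in> J"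
    using assms(2,4) interior_subset by blast
  show ?thesis
  proof
    assume "pointwise_1_type_first_kind I J z frame_x (frame_y f)"
    then obtain \<phi> a b where ab: "a \<in> I" "b \<in> J" "\<phi> a b \<noteq> 0"
      and eq: "\<And>u v. u \<in> I \<Longrightarrow> v \<in> J \<Longrightarrow> ?L u v = \<phi> u v *\<^sub>R \<Gamma> u v"
      unfolding pointwise_1_type_first_kind_def by blast
    have zero: "spherical_curvature J l n v = 0" if "v \<in> J" for v
      using curvature_zero_of_laplacian_eq[OF u0 that eq[OF u0 that]] .
    have phi: "\<phi> u v = ?\<phi> u" and ode: "f u * p1 u = f1 u * g1 u" if "u \<in> I" "v \<in> J" for u v
      using laplacian_eq_iff[OF that zero, of "\<phi> u v"] eq[OF that] by auto
    \<comment> \<open>A nonzero value of the factor excludes the totally degenerate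
      solution.\<close>
    have "g1 a \<noteq> 0 \<or> w a \<noteq> 0"
      using ab(3) phi[OF ab(1,2)] by auto
    then have "I \<subseteq> closure {u \<in> I. (f1 u)\<^sup>2 > 1}"
      using nondegenerate_points_dense[OF ode[OF _ v0] ab(1)] by blast
    then have "meridian_from_ode I f g"
      unfolding meridian_from_ode_def
      using meridian_ode_iff ode[OF _ v0] f1_square_gt_1_iff sqrt_f1 by simp
    with zero show "(\<forall>v\<in>J. spherical_curvature J l n v = 0) \<and> meridian_from_ode I f g"
      by blast
  next
    assume R: "(\<forall>v\<in>J. spherical_curvature J l n v = 0) \<and> meridian_from_ode I f g"
    then have dense: "I \<subseteq> closure {u \<in> I. (f1 u)\<^sup>2 > 1}"
      by (simp add: meridian_from_ode_def)
    have "f u * p1 u = f1 u * g1 u" if "u \<in> I" "g1 u \<noteq> 0" for u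
      using R that meridian_ode_iff f1_square_gt_1_iff by (simp add: meridian_from_ode_def)
    then have ode: "f u * p1 u = f1 u * g1 u" if "u \<in> I" for u
      using ode_everywhere[OF dense _ that] by blast
    have "smooth_on_ivl I ?\<phi>"
    proof -
      have "smooth_on_ivl I (\<lambda>u. f1 u * g2 u + - (g1 u * f2 u))"
        by (intro I.smooth_add I.smooth_minus I.smooth_mult smooth_fg)
      then have "smooth_on_ivl I w" by (simp add: w_def[abs_def])
      then show ?thesis
        by (intro I.smooth_add I.smooth_minus I.smooth_mult I.smooth_inverse smooth_fg f_nonzero)
    qed
    then have smooth: "smooth_on_rect I J (\<lambda>u v. ?\<phi> u)"
      by (intro smooth_on_rect_fst I.nondegenerate_interval_axioms J.nondegenerate_interval_axioms)
    \<comment> \<open>Density supplies a point with g' different from 0, where the factor is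
      strictly negative.\<close>
    have "{u \<in> I. (f1 u)\<^sup>2 > 1} \<noteq> {}"
      using dense u0 by (metis closure_empty empty_iff subsetD)
    then obtain a where a: "a \<in> I" "g1 a \<noteq> 0"
      using f1_square_gt_1_iff by blast
    then have "g1 a * inverse (f a) \<noteq> 0"
      using f_nonzero by simp
    then have "(g1 a * inverse (f a)) * (g1 a * inverse (f a)) > 0"
      using not_real_square_gt_zero by blast
    then have "?\<phi> a \<noteq> 0"
      using zero_le_square[of "w a"] by linarith
    moreover have "?L u v = ?\<phi> u *\<^sub>R \<Gamma> u v" if "u \<in> I" "v \<in> J" for u v
      using laplacian_eq_iff[OF that] R ode[OF that(1)] by blast
    ultimately show "pointwise_1_type_first_kind I J z frame_x (frame_y f)"
      unfolding pointwise_1_type_first_kind_def using smooth a(1) v0 by blast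
  qed
qed

end
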